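(* Let $\boldsymbol\mu\in\mathbb R^p$, let $\boldsymbol\Sigma$ be a $p\times p$ positive definite matrix, $\boldsymbol\lambda\in\mathbb R^p$, $\tau\in\mathbb R$, let $\mathbf a,\mathbf b$ be (possibly infinite) lower and upper limits in dimension $p$, and let $\boldsymbol\kappa$ be a $p$-vector of nonnegative integers. Put $\boldsymbol\kappa^*=(\boldsymbol\kappa^\top,0)^\top$, $\mathbf a^*=(\mathbf a^\top,-\infty)^\top$, $\mathbf b^*=(\mathbf b^\top,\tilde\tau)^\top$. Then $$\mathcal F^p_{\boldsymbol\kappa}(\mathbf a,\mathbf b;\boldsymbol\mu,\boldsymbol\Sigma,\boldsymbol\lambda,\tau)=\xi^{-1}F^{p+1}_{\boldsymbol\kappa^*}(\mathbf a^*,\mathbf b^*;\boldsymbol\mu^*,\boldsymbol\Omega).$$ In particular, for $\boldsymbol\kappa=\mathbf 0$, $$\mathcal L_p(\mathbf a,\mathbf b;\boldsymbol\mu,\boldsymbol\Sigma,\boldsymbol\lambda,\tau)=\xi^{-1}L_{p+1}(\mathbf a^*,\mathbf b^*;\boldsymbol\mu^*,\boldsymbol\Omega).$$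
   Context: $\phi_p(\cdot;\boldsymbol\mu,\boldsymbol\Sigma)$ is the density of the $p$-variate normal distribution with mean $\boldsymbol\mu$ and covariance $\boldsymbol\Sigma$; $\Phi_1$ is the standard univariate normal cdf; $\boldsymbol\Sigma^{1/2}$ is the symmetric positive definite square root of $\boldsymbol\Sigma$, with inverse $\boldsymbol\Sigma^{-1/2}$. Extended skew-normal (ESN) density: $$ESN_p(\mathbf y;\boldsymbol\mu,\boldsymbol\Sigma,\boldsymbol\lambda,\tau)=\xi^{-1}\phi_p(\mathbf y;\boldsymbol\mu,\boldsymbol\Sigma)\,\Phi_1\big(\tau+\boldsymbol\lambda^\top\boldsymbol\Sigma^{-1/2}(\mathbf y-\boldsymbol\mu)\big),\qquad \xi=\Phi_1(\tilde\tau),\quad \tilde\tau=\tau/(1+\boldsymbol\lambda^\top\boldsymbol\lambda)^{1/2}.$$ Set $\boldsymbol\Delta=\boldsymbol\Sigma^{1/2}\boldsymbol\lambda/(1+\boldsymbol\lambda^\top\boldsymbol\lambda)^{1/2}$, $\boldsymbol\mu^*=(\boldsymbol\mu^\top,0)^\top\in\mathbb R^{p+1}$ and $\boldsymbol\Omega=\begin{pmatrix}\boldsymbol\Sigma&-\boldsymbol\Delta\\-\boldsymbol\Delta^\top&1\end{pmatrix}$. With $\mathbf x^{\boldsymbol\kappa}=\prod_i x_i^{k_i}$ and $\int_{\mathbf a}^{\mathbf b}=\int_{a_1}^{b_1}\cdots\int_{a_p}^{b_p}$, $$\mathcal F^p_{\boldsymbol\kappa}(\mathbf a,\mathbf b;\boldsymbol\mu,\boldsymbol\Sigma,\boldsymbol\lambda,\tau)=\int_{\mathbf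 a}^{\mathbf b}\mathbf x^{\boldsymbol\kappa}ESN_p(\mathbf x;\boldsymbol\mu,\boldsymbol\Sigma,\boldsymbol\lambda,\tau)\,d\mathbf x,\qquad F^p_{\boldsymbol\kappa}(\mathbf a,\mathbf b;\boldsymbol\mu,\boldsymbol\Sigma)=\int_{\mathbf a}^{\mathbf b}\mathbf x^{\boldsymbol\kappa}\phi_p(\mathbf x;\boldsymbol\mu,\boldsymbol\Sigma)\,d\mathbf x,$$ and $\mathcal L_p$, $L_p$ denote $\mathcal F^p_{\mathbf 0}$, $F^p_{\mathbf 0}$ respectively. *)

theory Defs
  imports "HOL-Probability.Probability"
begin

text \<open>
  Vectors in dimension \<open>p\<close> are indexed by a finite type \<open>'n\<close> with \<open>CARD('n) = p\<close>. Dimension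
  \<open>p + 1\<close> is indexed by \<open>'n option\<close>: \<open>Some i\<close> is the old coordinate \<open>i\<close> and \<open>None\<close> is the
  appended last coordinate.
\<close>

definition snoc_vec :: "'a ^ 'n \<Rightarrow> 'a \<Rightarrow> 'a ^ 'n option" where
  "snoc_vec v c = (\<chi> i. case i of Some j \<Rightarrow> v $ j | None \<Rightarrow> c)"

definition pos_def :: "real ^ 'n ^ 'n \<Rightarrow> bool" where
  "pos_def S \<longleftrightarrow> transpose S = S \<and> (\<forall>x. x \<noteq> 0 \<longrightarrow> x \<bullet> (S *v x) > 0)"

definition mat_sqrt :: "real ^ 'n ^ 'n \<Rightarrow> real ^ 'n ^ 'n" where
  "mat_sqrt S = (THE R. pos_def R \<and> R ** R = S)"

definition normal_dens :: "real ^ 'n \<Rightarrow> real ^ 'n ^ 'n \<Rightarrow> real ^ 'n \<Rightarrow> real" where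
  "normal_dens \<mu> S x =
     exp (- ((x - \<mu>) \<bullet> (matrix_inv S *v (x - \<mu>))) / 2) / sqrt ((2 * pi) ^ CARD('n) * det S)"

abbreviation Phi1 :: "real \<Rightarrow> real" where
  "Phi1 \<equiv> cdf std_normal_distribution"

definition tau_tilde :: "real ^ 'n \<Rightarrow> real \<Rightarrow> real" where
  "tau_tilde l \<tau> = \<tau> / sqrt (1 + l \<bullet> l)"

definition esn_xi :: "real ^ 'n \<Rightarrow> real \<Rightarrow> real" where
  "esn_xi l \<tau> = Phi1 (tau_tilde l \<tau>)"

definition esn_dens ::
  "real ^ 'n \<Rightarrow> real ^ 'n ^ 'n \<Rightarrow> real ^ 'n \<Rightarrow> real \<Rightarrow> real ^ 'n \<Rightarrow> real" where
  "esn_dens \<mu> S l \<tau> y =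
     inverse (esn_xi l \<tau>) * normal_dens \<mu> S y *
     Phi1 (\<tau> + l \<bullet> (matrix_inv (mat_sqrt S) *v (y - \<mu>)))"

definition esn_Delta :: "real ^ 'n ^ 'n \<Rightarrow> real ^ 'n \<Rightarrow> real ^ 'n" where
  "esn_Delta S l = (1 / sqrt (1 + l \<bullet> l)) *\<^sub>R (mat_sqrt S *v l)"

definition esn_Omega :: "real ^ 'n ^ 'n \<Rightarrow> real ^ 'n \<Rightarrow> real ^ 'n option ^ 'n option" where
  "esn_Omega S l =
     (\<chi> i j. case i of
        Some k \<Rightarrow> (case j of Some m \<Rightarrow> S $ k $ m | None \<Rightarrow> - esn_Delta S l $ k)
      | None \<Rightarrow> (case j of Some m \<Rightarrow> - esn_Delta S l $ m | None \<Rightarrow> 1))"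

definition monom_vec :: "real ^ 'n \<Rightarrow> nat ^ 'n \<Rightarrow> real" where
  "monom_vec x \<kappa> = (\<Prod>i\<in>UNIV. x $ i ^ (\<kappa> $ i))"

text \<open>
  The limits of integration are extended reals. The integral from \<open>a\<close> to \<open>b\<close> is the Lebesgue
  integral over the box of real vectors between them; this box is empty, and the integral zero,
  if \<open>a $ i > b $ i\<close> for some \<open>i\<close>.
\<close>

definition ebox :: "ereal ^ 'n \<Rightarrow> ereal ^ 'n \<Rightarrow> (real ^ 'n) set" where
  "ebox a b = {x. \<forall>i. a $ i \<le> ereal (x $ i) \<and> ereal (x $ i) \<le> b $ i}"

definition esn_F ::
  "nat ^ 'n \<Rightarrow> ereal ^ 'n \<Rightarrow> ereal ^ 'n \<Rightarrow> real ^ 'n \<Rightarrow> real ^ 'n ^ 'n \<Rightarrow> real ^ 'n \<Rightarrow> real \<Rightarrow> real" where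
  "esn_F \<kappa> a b \<mu> S l \<tau> = (LINT x:ebox a b|lborel. monom_vec x \<kappa> * esn_dens \<mu> S l \<tau> x)"

definition normal_F ::
  "nat ^ 'n \<Rightarrow> ereal ^ 'n \<Rightarrow> ereal ^ 'n \<Rightarrow> real ^ 'n \<Rightarrow> real ^ 'n ^ 'n \<Rightarrow> real" where
  "normal_F \<kappa> a b \<mu> S = (LINT x:ebox a b|lborel. monom_vec x \<kappa> * normal_dens \<mu> S x)"

definition esn_L ::
  "ereal ^ 'n \<Rightarrow> ereal ^ 'n \<Rightarrow> real ^ 'n \<Rightarrow> real ^ 'n ^ 'n \<Rightarrow> real ^ 'n \<Rightarrow> real \<Rightarrow> real" where
  "esn_L = esn_F 0"

definition normal_L ::
  "ereal ^ 'n \<Rightarrow> ereal ^ 'n \<Rightarrow> real ^ 'n \<Rightarrow> real ^ 'n ^ 'n \<Rightarrow> real" where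
  "normal_L = normal_F 0"

end

theory Submission
  imports Defs
begin

text \<open>
  Write \<open>\<Sigma>\<close> and \<open>\<lambda>\<close> for \<open>S\<close> and \<open>l\<close>. The matrix \<open>\<Omega>\<close> is the covariance of a Gaussian pair
  \<open>(X, U)\<close> with mean \<open>(\<mu>, 0)\<close> in which \<open>X\<close> has law
  \<open>N(\<mu>, \<Sigma>)\<close>, \<open>U\<close> is standard normal and the covariance of \<open>X\<close> and \<open>U\<close> is \<open>-\<Delta>\<close>. Given \<open>X = x\<close>,
  the variable \<open>U\<close> is normal with mean \<open>m(x) = -\<Delta>\<^sup>T \<Sigma>\<^bsup>-1\<^esup> (x - \<mu>)\<close> and variance
  \<open>\<sigma>\<^sup>2 = 1 - \<Delta>\<^sup>T \<Sigma>\<^bsup>-1\<^esup> \<Delta> = 1 / (1 + \<lambda>\<^sup>T \<lambda>)\<close>. So the probability of \<open>U \<le> \<tau> / sqrt (1 + \<lambda>\<^sup>T \<lambda>)\<close>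
  given \<open>X = x\<close> is \<open>\<Phi>(\<tau> + \<lambda>\<^sup>T \<Sigma>\<^bsup>-1/2\<^esup> (x - \<mu>))\<close>, which is exactly the skewing factor of the
  extended skew-normal density. Integrating out the last coordinate of the \<open>(p+1)\<close>-variate
  Gaussian integral therefore gives the \<open>p\<close>-variate extended skew-normal integral, up to the
  constant \<open>\<xi>\<close>; the monomial passes through because the exponent appended to \<open>\<kappa>\<close> is zero.
\<close>

text \<open>
  Three ingredients carry this argument. First, \<open>mat_sqrt\<close> is a definite description, so
  existence and uniqueness of the positive definite square root have to be established
  (\<open>pos_def_sqrt_exists\<close>, \<open>pos_def_sqrt_unique\<close>). Second, the Gaussian density of a bordered
  covariance matrix factors into a marginal and a conditional density (\<open>normal_dens_bordered\<close>);
  this rests on the Schur complement, which gives both the determinant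
  (\<open>det_bordered_symmetric\<close>) and the quadratic form of the inverse
  (\<open>bordered_inverse_quadratic_form\<close>). Third, Lebesgue measure in dimension \<open>p + 1\<close> is the product
  of Lebesgue measures in dimensions \<open>p\<close> and \<open>1\<close> (\<open>lborel_snoc_vec\<close>), and a nonnegative kernel can
  be integrated out one coordinate at a time (\<open>integral_kernel\<close>).
\<close>

section \<open>Positive definite matrices\<close>

lemma inner_symmetric_matrix:
  fixes A :: "real ^ 'n ^ 'n"
  assumes "transpose A = A"
  shows "x \<bullet> (A *v y) = (A *v x) \<bullet> y"
  by (metis assms dot_lmul_matrix vector_transpose_matrix)

lemma matrix_inv_mult:
  fixes A :: "real ^ 'n ^ 'n"
  assumes "invertible A"
  shows "A ** matrix_inv A = mat 1" "matrix_inv A ** A = mat 1"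
proof -
  have "A ** matrix_inv A = mat 1 \<and> matrix_inv A ** A = mat 1"
    using assms unfolding invertible_def matrix_inv_def by (rule someI_ex)
  then show "A ** matrix_inv A = mat 1" "matrix_inv A ** A = mat 1"
    by auto
qed

lemma matrix_inv_vector_eq_iff:
  fixes A :: "real ^ 'n ^ 'n"
  assumes "invertible A"
  shows "matrix_inv A *v x = y \<longleftrightarrow> x = A *v y"
  by (metis assms matrix_inv_mult matrix_vector_mul_assoc matrix_vector_mul_lid)

lemma pos_def_invertible:
  fixes S :: "real ^ 'n ^ 'n"
  assumes "pos_def S"
  shows "invertible S"
proof -
  have "x = 0" if "S *v x = 0" for x
    using assms that unfolding pos_def_def by (metis inner_zero_right less_irrefl)
  then show ?thesis
    by (simp add: invertible_left_inverse matrix_left_invertible_ker)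
qed

text \<open>
  The quadratic form has a positive minimum on the compact unit sphere, and it is homogeneous of
  degree two.
\<close>

lemma pos_def_coercive:
  fixes S :: "real ^ 'n ^ 'n"
  assumes "pos_def S"
  obtains m where "m > 0" "\<And>x. m * (norm x)\<^sup>2 \<le> x \<bullet> (S *v x)"
proof -
  let ?q = "\<lambda>x. x \<bullet> (S *v x)"
  have "continuous_on (sphere 0 1) ?q"
    by (intro continuous_intros)
  then obtain z where z: "z \<in> sphere 0 1" "\<And>x. x \<in> sphere 0 1 \<Longrightarrow> ?q z \<le> ?q x"
    using continuous_attains_inf[of "sphere (0::real ^ 'n) 1" ?q] by auto
  have "?q z > 0"
  proof -
    have "z \<noteq> 0"
      using z(1) by auto
    then show ?thesis
      using assms by (simp add: pos_def_def)
  qed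
  moreover have "?q z * (norm x)\<^sup>2 \<le> ?q x" for x
  proof (cases "x = 0")
    case False
    have "?q z \<le> ?q (inverse (norm x) *\<^sub>R x)"
      using False by (intro z(2)) simp
    also have "\<dots> = ?q x / (norm x)\<^sup>2"
      by (simp add: matrix_vector_mult_scaleR power2_eq_square field_simps)
    finally show ?thesis
      using False by (simp add: field_simps)
  qed simp
  ultimately show thesis ..
qed

text \<open>
  Nonnegativity of the form at \<open>r x - A x\<close>, with the upper bound at \<open>A x\<close>, gives
  \<open>\<bar>A x\<bar>\<^sup>2 \<le> r (x \<bullet> A x)\<close>; the upper bound at \<open>x\<close> does the rest.
\<close>

lemma norm_le_of_quadratic_form_le:
  fixes A :: "real ^ 'n ^ 'n"
  assumes sym: "transpose A = A" and "r > 0"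
    and nonneg: "\<And>x. 0 \<le> x \<bullet> (A *v x)"
    and le: "\<And>x. x \<bullet> (A *v x) \<le> r * (norm x)\<^sup>2"
  shows "norm (A *v x) \<le> r * norm x"
proof -
  let ?y = "A *v x"
  have "0 \<le> (r *\<^sub>R x - ?y) \<bullet> (A *v (r *\<^sub>R x - ?y))"
    by (rule nonneg)
  also have "\<dots> = r\<^sup>2 * (x \<bullet> ?y) - 2 * r * (norm ?y)\<^sup>2 + ?y \<bullet> (A *v ?y)"
    using inner_symmetric_matrix[OF sym, of x ?y]
    by (simp add: matrix_vector_mult_diff_distrib matrix_vector_mult_scaleR inner_diff_left
        inner_diff_right power2_norm_eq_inner algebra_simps) (simp add: power2_eq_square)
  also have "\<dots> \<le> r\<^sup>2 * (r * (norm x)\<^sup>2) - 2 * r * (norm ?y)\<^sup>2 + r * (norm ?y)\<^sup>2"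
    using le[of ?y] le[of x] by (intro add_mono diff_right_mono mult_left_mono) auto
  finally have "r * (norm ?y)\<^sup>2 \<le> r * (r * norm x)\<^sup>2"
    by (simp add: power2_eq_square algebra_simps)
  then have "(norm ?y)\<^sup>2 \<le> (r * norm x)\<^sup>2"
    using \<open>r > 0\<close> by (rule mult_left_le_imp_le)
  then show ?thesis
    by (rule power2_le_imp_le) (use \<open>r > 0\<close> in simp)
qed

text \<open>
  A solution of \<open>Y = (A + Y\<^sup>2) / 2\<close> satisfies \<open>(1 - Y)\<^sup>2 = 1 - A\<close>, so this is the square root of an
  operator at distance less than one from the identity. The right-hand side is a contraction of the self-adjoint
  operators of norm at most \<open>r = 1 - sqrt (1 - q)\<close>.
\<close>

lemma blinfun_sqrt_fixed_point:
  fixes A :: "'a::{real_inner,banach} \<Rightarrow>\<^sub>L 'a"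
  assumes q: "norm A \<le> q" "q < 1"
    and sym: "\<And>x y. x \<bullet> A y = A x \<bullet> y"
  shows "\<exists>Y. Y = (1/2) *\<^sub>R (A + (Y o\<^sub>L Y)) \<and> norm Y < 1 \<and> (\<forall>x y. x \<bullet> Y y = Y x \<bullet> y)"
proof -
  have "0 \<le> q" using q norm_ge_zero[of A] by linarith
  define r where "r = 1 - sqrt (1 - q)"
  have r: "0 \<le> r" "r < 1"
    using \<open>0 \<le> q\<close> \<open>q < 1\<close> by (auto simp: r_def)
  \<comment> \<open>The radius solves the scalar version of the equation, so that the ball of radius \<open>r\<close> is
    mapped into itself.\<close>
  have r_fixed: "(q + r\<^sup>2) / 2 = r"
    using \<open>q < 1\<close> by (simp add: r_def power2_diff)
  let ?f = "\<lambda>Y :: 'a \<Rightarrow>\<^sub>L 'a. (1/2) *\<^sub>R (A + (Y o\<^sub>L Y))"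
  let ?X = "{Y :: 'a \<Rightarrow>\<^sub>L 'a. norm Y \<le> r \<and> (\<forall>x y. x \<bullet> blinfun_apply Y y = blinfun_apply Y x \<bullet> y)}"
  have "closed ?X"
    by (intro closed_Collect_conj closed_Collect_le closed_Collect_all closed_Collect_eq
        continuous_intros)
  then have complete: "Topological_Spaces.complete ?X"
    by (simp only: complete_eq_closed)
  have nonempty: "?X \<noteq> {}"
    using r(1) by (auto intro!: exI[of _ 0])
  have maps: "?f ` ?X \<subseteq> ?X"
  proof clarify
    fix Y :: "'a \<Rightarrow>\<^sub>L 'a" assume Y: "norm Y \<le> r" "\<forall>x y. x \<bullet> Y y = Y x \<bullet> y"
    have "norm (A + (Y o\<^sub>L Y)) \<le> q + r\<^sup>2"
      using norm_triangle_ineq[of A "Y o\<^sub>L Y"] norm_blinfun_compose[of Y Y] q(1)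
        mult_mono[OF Y(1) Y(1) r(1)] by (simp add: power2_eq_square)
    then have "norm (?f Y) \<le> r"
      using r_fixed by simp
    moreover have "x \<bullet> ?f Y y = ?f Y x \<bullet> y" for x y
    proof -
      have "x \<bullet> Y (Y y) = Y (Y x) \<bullet> y"
        by (rule trans[OF Y(2)[rule_format] Y(2)[rule_format]])
      then show ?thesis
        by (simp add: blinfun.bilinear_simps inner_add_left inner_add_right sym)
    qed
    ultimately show "norm (?f Y) \<le> r \<and> (\<forall>x y. x \<bullet> ?f Y y = ?f Y x \<bullet> y)"
      by blast
  qed
  have contraction: "dist (?f Y) (?f Z) \<le> r * dist Y Z" if "norm Y \<le> r" "norm Z \<le> r" for Y Z
  proof -
    have "(Y o\<^sub>L Y) - (Z o\<^sub>L Z) = (Y o\<^sub>L (Y - Z)) + ((Y - Z) o\<^sub>L Z)"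
      by (rule blinfun_eqI) (simp add: blinfun.bilinear_simps)
    then have "norm ((Y o\<^sub>L Y) - (Z o\<^sub>L Z)) \<le> norm Y * norm (Y - Z) + norm (Y - Z) * norm Z"
      by (simp only: norm_triangle_mono norm_blinfun_compose)
    also have "\<dots> \<le> r * norm (Y - Z) + norm (Y - Z) * r"
      using that by (intro add_mono mult_right_mono mult_left_mono) auto
    finally have "norm ((Y o\<^sub>L Y) - (Z o\<^sub>L Z)) \<le> 2 * (r * norm (Y - Z))"
      by simp
    moreover have "?f Y - ?f Z = (1/2) *\<^sub>R ((Y o\<^sub>L Y) - (Z o\<^sub>L Z))"
      by (simp add: algebra_simps)
    ultimately show ?thesis
      unfolding dist_norm by simp
  qed
  have "\<exists>!Y. Y \<in> ?X \<and> ?f Y = Y"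
    by (rule Banach_fix[OF complete nonempty r(1,2) maps]) (simp add: contraction)
  then obtain Y where Y: "Y \<in> ?X" "?f Y = Y"
    by blast
  then have "norm Y < 1"
    using r(2) by simp
  moreover have "\<forall>x y. x \<bullet> Y y = Y x \<bullet> y"
    using Y(1) by simp
  ultimately show ?thesis
    using Y(2)[symmetric] by blast
qed

text \<open>
  Scaling by a large constant \<open>c\<close> makes \<open>A = 1 - S / c\<close> positive semidefinite with norm below one.
  If \<open>Y\<close> is the fixed point for \<open>A\<close>, then \<open>sqrt c (1 - Y)\<close> squares to \<open>S\<close>, and it is positive definite
  because the norm of \<open>Y\<close> is below one.
\<close>

lemma pos_def_sqrt_exists:
  fixes S :: "real ^ 'n ^ 'n"
  assumes "pos_def S"
  shows "\<exists>R. pos_def R \<and> R ** R = S"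
proof -
  obtain m where m: "m > 0" "\<And>x. m * (norm x)\<^sup>2 \<le> x \<bullet> (S *v x)"
    using pos_def_coercive[OF assms] by blast
  have symS: "transpose S = S"
    using assms by (simp add: pos_def_def)
  \<comment> \<open>The norm of \<open>S\<close> makes \<open>A\<close> below positive semidefinite; the summand \<open>2 * m\<close> ensures \<open>m < c\<close>,
    so that the bound \<open>q = 1 - m / c\<close> on its norm lies strictly between 0 and 1.\<close>
  define c where "c = onorm ((*v) S) + 2 * m"
  have bound: "x \<bullet> (S *v x) \<le> onorm ((*v) S) * (norm x)\<^sup>2" for x
  proof -
    have "x \<bullet> (S *v x) \<le> norm x * norm (S *v x)"
      by (rule norm_cauchy_schwarz)
    also have "\<dots> \<le> norm x * (onorm ((*v) S) * norm x)"
      by (intro mult_left_mono onorm) auto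
    finally show ?thesis by (simp add: power2_eq_square mult_ac)
  qed
  have c: "c > m"
    using m(1) onorm_pos_le[of "(*v) S"] by (simp add: c_def)
  then have "c > 0" using m by simp
  define q where "q = 1 - m / c"
  have q: "0 < q" "q < 1" using c m(1) by (auto simp: q_def)
  define A where "A = mat 1 - (1 / c) *\<^sub>R S"
  have Av: "A *v x = x - (1 / c) *\<^sub>R (S *v x)" for x
    by (simp add: A_def matrix_vector_mult_diff_rdistrib scaleR_matrix_vector_assoc)
  have symA: "transpose A = A"
    using symS by (simp add: A_def transpose_def mat_def vec_eq_iff)
  have quadA: "y \<bullet> (A *v y) = (norm y)\<^sup>2 - y \<bullet> (S *v y) / c" for y
    by (simp add: Av inner_diff_right power2_norm_eq_inner)
  have quadA_nonneg: "0 \<le> y \<bullet> (A *v y)" for y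
  proof -
    have "y \<bullet> (S *v y) \<le> c * (norm y)\<^sup>2"
    proof (rule order_trans[OF bound])
      show "onorm ((*v) S) * (norm y)\<^sup>2 \<le> c * (norm y)\<^sup>2"
        using m(1) by (intro mult_right_mono) (auto simp: c_def)
    qed
    then show ?thesis
      using \<open>c > 0\<close> by (simp add: quadA field_simps)
  qed
  have quadA_le: "y \<bullet> (A *v y) \<le> q * (norm y)\<^sup>2" for y
    using \<open>c > 0\<close> m(2)[of y] by (simp add: quadA q_def field_simps)
  have normA: "norm (A *v x) \<le> q * norm x" for x
    by (rule norm_le_of_quadratic_form_le[OF symA q(1) quadA_nonneg quadA_le])
  define A' where "A' = Blinfun ((*v) A)"
  have A': "A' x = A *v x" for x
    by (simp add: A'_def bounded_linear_Blinfun_apply)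
  have normA': "norm A' \<le> q"
    using q normA by (intro norm_blinfun_bound) (auto simp: A')
  have symA': "x \<bullet> A' y = A' x \<bullet> y" for x y
    by (simp add: A' inner_symmetric_matrix[OF symA])
  obtain Y where Y: "Y = (1/2) *\<^sub>R (A' + (Y o\<^sub>L Y))" "norm Y < 1"
      "\<And>x y. x \<bullet> Y y = Y x \<bullet> y"
    using blinfun_sqrt_fixed_point[OF normA' q(2) symA'] by blast
  define R where "R = matrix (\<lambda>x. sqrt c *\<^sub>R (x - Y x))"
  have "linear (\<lambda>x. sqrt c *\<^sub>R (x - Y x))"
    by (intro linearI) (simp_all add: blinfun.bilinear_simps algebra_simps)
  then have Rv: "R *v x = sqrt c *\<^sub>R (x - Y x)" for x
    by (simp add: R_def matrix_works)
  have "R *v (R *v x) = S *v x" for x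
  proof -
    have "Y x = (1/2) *\<^sub>R (A' x + Y (Y x))"
      by (subst Y(1)) (simp add: blinfun.bilinear_simps)
    then have "2 *\<^sub>R Y x = 2 *\<^sub>R ((1/2) *\<^sub>R (A' x + Y (Y x)))"
      by simp
    then have "Y x + Y x = A' x + Y (Y x)"
      by (simp add: scaleR_2)
    then have "x - Y x - Y x + Y (Y x) = (1 / c) *\<^sub>R (S *v x)"
      unfolding A' Av by (simp add: algebra_simps)
    moreover have "R *v (R *v x) = c *\<^sub>R (x - Y x - Y x + Y (Y x))"
      using \<open>c > 0\<close> by (simp add: Rv blinfun.bilinear_simps algebra_simps)
    ultimately show ?thesis
      using \<open>c > 0\<close> by simp
  qed
  then have "R ** R = S"
    by (simp add: matrix_eq flip: matrix_vector_mul_assoc)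
  moreover have "transpose R = R"
  proof -
    have "x \<bullet> (R *v y) = x \<bullet> (transpose R *v y)" for x y
    proof -
      have "x \<bullet> (R *v y) = (R *v x) \<bullet> y"
        using Y(3)[of x y] by (simp add: Rv inner_diff_left inner_diff_right)
      also have "\<dots> = (x v* transpose R) \<bullet> y"
        by simp
      finally show ?thesis
        by (simp only: dot_lmul_matrix)
    qed
    then show ?thesis
      unfolding matrix_eq by (metis vector_eq_ldot)
  qed
  moreover have "x \<bullet> (R *v x) > 0" if "x \<noteq> 0" for x
  proof -
    have "x \<bullet> Y x \<le> norm x * norm (Y x)"
      by (rule norm_cauchy_schwarz)
    also have "\<dots> \<le> norm x * (norm Y * norm x)"
      by (intro mult_left_mono norm_blinfun) auto
    also have "\<dots> < norm x * (1 * norm x)"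
      using that Y(2) by (intro mult_strict_left_mono mult_strict_right_mono) auto
    finally show ?thesis
      using \<open>c > 0\<close> by (simp add: Rv inner_diff_right dot_square_norm power2_eq_square)
  qed
  ultimately show ?thesis
    unfolding pos_def_def by blast
qed

lemma trace_sandwich:
  fixes D R :: "real ^ 'n ^ 'n"
  assumes "transpose D = D"
  shows "trace (D ** (R ** D)) = (\<Sum>i\<in>UNIV. column i D \<bullet> (R *v column i D))"
proof -
  have "D ** (R ** D) = transpose D ** (R ** D)"
    using assms by simp
  then show ?thesis
    by (simp add: trace_def matrix_matrix_mult_def column_def inner_vec_def matrix_vector_mult_def transpose_def)
qed

text \<open>
  With \<open>D = R - T\<close> the hypothesis reads \<open>R D + D T = 0\<close>. Multiplying by \<open>D\<close> and taking traces, by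
  cyclicity \<open>tr (D R D) + tr (D T D) = 0\<close>. Both traces are sums of values of positive definite
  forms at the columns of \<open>D\<close>, so all columns vanish.
\<close>

lemma pos_def_sqrt_unique:
  fixes R T :: "real ^ 'n ^ 'n"
  assumes R: "pos_def R" and T: "pos_def T" and eq: "R ** R = T ** T"
  shows "R = T"
proof -
  define D where "D = R - T"
  have symD: "transpose D = D"
    using R T by (simp add: D_def pos_def_def transpose_def vec_eq_iff)
  have nonneg: "x \<bullet> (R *v x) \<ge> 0" "x \<bullet> (T *v x) \<ge> 0" for x
    using R T unfolding pos_def_def by (metis inner_zero_left less_eq_real_def)+
  have "R ** D + D ** T = R ** R - T ** T"
    unfolding D_def by (simp add: matrix_eq matrix_vector_mult_add_rdistrib
      matrix_vector_mult_diff_rdistrib matrix_vector_mult_diff_distrib flip: matrix_vector_mul_assoc)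
  then have "R ** D + D ** T = 0"
    using eq by simp
  then have "trace (D ** (R ** D)) + trace (D ** (D ** T)) = 0"
    by (simp flip: trace_add matrix_add_ldistrib) (simp add: trace_def)
  moreover have "trace (D ** (D ** T)) = trace (D ** (T ** D))"
    by (metis matrix_mul_assoc trace_mul_sym)
  ultimately have "(\<Sum>i\<in>UNIV. column i D \<bullet> (R *v column i D) + column i D \<bullet> (T *v column i D)) = 0"
    by (simp add: trace_sandwich[OF symD] sum.distrib)
  then have "column i D \<bullet> (R *v column i D) + column i D \<bullet> (T *v column i D) = 0" for i
    using nonneg by (subst (asm) sum_nonneg_eq_0_iff) auto
  then have "column i D \<bullet> (R *v column i D) = 0" for i
    using nonneg by (smt (verit))
  then have "column i D = 0" for i
    using R unfolding pos_def_def by (metis less_irrefl)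
  then have "D = 0"
    by (simp add: column_def vec_eq_iff)
  then show ?thesis by (simp add: D_def)
qed

lemma mat_sqrt:
  assumes "pos_def S"
  shows "pos_def (mat_sqrt S)" "mat_sqrt S ** mat_sqrt S = S"
proof -
  have "\<exists>!R. pos_def R \<and> R ** R = S"
    using pos_def_sqrt_exists[OF assms] pos_def_sqrt_unique by metis
  then have "pos_def (mat_sqrt S) \<and> mat_sqrt S ** mat_sqrt S = S"
    unfolding mat_sqrt_def by (rule theI')
  then show "pos_def (mat_sqrt S)" "mat_sqrt S ** mat_sqrt S = S"
    by auto
qed

section \<open>Appending a coordinate, bordered matrices\<close>

lemma snoc_vec_nth [simp]: "snoc_vec v c $ Some i = v $ i" "snoc_vec v c $ None = c"
  by (simp_all add: snoc_vec_def)

text \<open>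
  This reduces statements about boxes and matrices in dimension \<open>p + 1\<close> to their two blocks.
\<close>

lemma snoc_vec_cases:
  obtains v c where "z = snoc_vec v c"
proof
  show "z = snoc_vec (\<chi> i. z $ Some i) (z $ None)"
    by (simp add: vec_eq_iff snoc_vec_def split: option.split)
qed

lemma sum_UNIV_option: "sum f (UNIV :: 'n::finite option set) = f None + (\<Sum>i\<in>UNIV. f (Some i))"
  by (simp add: UNIV_option_conv sum.reindex)

lemma prod_UNIV_option: "prod f (UNIV :: 'n::finite option set) = f None * (\<Prod>i\<in>UNIV. f (Some i))"
  by (simp add: UNIV_option_conv prod.reindex)

lemma snoc_vec_diff: "snoc_vec u s - snoc_vec v t = snoc_vec (u - v) (s - t :: 'a::ab_group_add)"
  by (simp add: vec_eq_iff snoc_vec_def split: option.split)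

lemma inner_snoc_vec: "snoc_vec u s \<bullet> snoc_vec v t = u \<bullet> v + s * (t::real)"
  by (simp add: inner_vec_def sum_UNIV_option)

text \<open>
  The block matrix with rows \<open>(A, d)\<close> and \<open>(e\<^sup>T, c)\<close>. Keeping \<open>d\<close> and \<open>e\<close> independent lets the same
  notation cover the block triangular matrices produced by row reduction.
\<close>

definition bordered :: "real ^ 'n ^ 'n \<Rightarrow> real ^ 'n \<Rightarrow> real ^ 'n \<Rightarrow> real \<Rightarrow>
  real ^ 'n option ^ 'n option" where
  "bordered A d e c = (\<chi> i. case i of Some k \<Rightarrow> snoc_vec (A $ k) (d $ k) | None \<Rightarrow> snoc_vec e c)"

lemma bordered_mult_snoc_vec:
  "bordered A d e c *v snoc_vec u s = snoc_vec (A *v u + s *\<^sub>R d) (e \<bullet> u + c * s)"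
  by (simp add: vec_eq_iff bordered_def matrix_vector_mult_def sum_UNIV_option inner_vec_def
      snoc_vec_def split: option.split)

text \<open>
  The appended row is zero outside its last entry. So in the Leibniz formula only permutations
  fixing the appended index contribute, and these are the permutations of the old indices.
\<close>

lemma det_bordered_zero: "det (bordered A d 0 c) = c * det A"
proof -
  let ?M = "bordered A d 0 c"
  let ?t = "\<lambda>p. of_int (sign p) * (\<Prod>i\<in>UNIV. ?M $ i $ p i)"
  have "det ?M = sum ?t {p. p permutes UNIV}"
    by (simp add: det_def)
  also have "\<dots> = sum ?t {p. p permutes range Some}"
  proof (rule sum.mono_neutral_right)
    show "\<forall>p\<in>{p. p permutes UNIV} - {p. p permutes range Some}. ?t p = 0"
    proof
      fix p :: "'a option \<Rightarrow> 'a option"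
      assume p: "p \<in> {p. p permutes UNIV} - {p. p permutes range Some}"
      have "p None \<noteq> None"
      proof
        assume "p None = None"
        then have "p x = x" if "x \<notin> range Some" for x
          using that by (cases x) auto
        with p show False
          by (auto simp: permutes_def)
      qed
      then obtain j where "p None = Some j"
        by blast
      then have "?M $ None $ p None = 0"
        by (simp add: bordered_def)
      then show "?t p = 0"
        by (auto simp: prod_UNIV_option)
    qed
  qed (auto intro: permutes_subset)
  also have "\<dots> = (\<Sum>q | q permutes UNIV. c * (of_int (sign q) * (\<Prod>i\<in>UNIV. A $ i $ q i)))"
  proof (rule sym, rule sum.reindex_bij_witness[where
        i = "map_permutation (range Some) the" and j = "map_permutation UNIV Some"])
    fix q :: "'a \<Rightarrow> 'a" assume q: "q \<in> {q. q permutes UNIV}"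
    then have q': "q permutes UNIV" by simp
    have bij: "bij_betw Some UNIV (range (Some :: 'a \<Rightarrow> _))"
      by (simp add: bij_betw_def)
    show "map_permutation (range Some) the (map_permutation UNIV Some q) = q"
      using map_permutation_compose_inv[OF bij q'] by simp
    have per: "map_permutation UNIV Some q permutes range Some"
      by (rule map_permutation_permutes[OF bij q'])
    then show "map_permutation UNIV Some q \<in> {p. p permutes range Some}"
      by simp
    have "map_permutation UNIV Some q (Some i) = Some (q i)" for i
      by (rule map_permutation_apply) auto
    moreover have "map_permutation UNIV Some q None = None"
      using per by (rule permutes_not_in) auto
    moreover have "sign (map_permutation UNIV Some q) = sign q"
      using q' by (intro sign_map_permutation) auto
    ultimately show "?t (map_permutation UNIV Some q) = c * (of_int (sign q) * (\<Prod>i\<in>UNIV. A $ i $ q i))"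
      by (simp add: prod_UNIV_option bordered_def)
  next
    fix p :: "'a option \<Rightarrow> 'a option" assume p: "p \<in> {p. p permutes range Some}"
    have bij: "bij_betw the (range Some) (UNIV :: 'a set)"
      by (rule bij_betwI[where g = Some]) auto
    show "map_permutation (range Some) the p \<in> {q. q permutes UNIV}"
      using map_permutation_permutes[OF bij, of p] p by simp
    show "map_permutation UNIV Some (map_permutation (range Some) the p) = p"
      by (rule map_permutation_compose_inv[OF bij]) (use p in auto)
  qed
  also have "\<dots> = c * det A"
    by (simp add: det_def sum_distrib_left)
  finally show ?thesis .
qed

text \<open>
  Subtracting from the last row the combination of the other rows with coefficients \<open>A\<^bsup>-1\<^esup> d\<close>
  clears its first block and leaves the Schur complement in the corner.
\<close>

lemma det_bordered_symmetric:
  fixes A :: "real ^ 'n ^ 'n"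
  assumes inv: "invertible A" and sym: "transpose A = A"
  shows "det (bordered A d d c) = (c - d \<bullet> (matrix_inv A *v d)) * det A"
proof -
  define w where "w = matrix_inv A *v d"
  have w: "A *v w = d"
    using matrix_inv_vector_eq_iff[OF inv] w_def by metis
  let ?M = "bordered A d d c"
  define x where "x = (\<Sum>k\<in>UNIV. (- w $ k) *s row (Some k) ?M)"
  have "x \<in> vec.span {row j ?M | j. j \<noteq> None}"
    unfolding x_def by (intro vec.span_sum vec.span_scale vec.span_base) auto
  then have "det ?M = det (\<chi> k. if k = None then row None ?M + x else row k ?M)"
    by (rule det_row_span[symmetric])
  also have "(\<chi> k. if k = None then row None ?M + x else row k ?M) = bordered A d 0 (c - d \<bullet> w)"
  proof -
    have "(\<Sum>k\<in>UNIV. w $ k * A $ k $ j) = d $ j" for j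
    proof -
      have "(\<Sum>k\<in>UNIV. w $ k * A $ k $ j) = (A *v w) $ j"
        using sym by (simp add: matrix_vector_mult_def transpose_def vec_eq_iff mult.commute)
      then show ?thesis by (simp add: w)
    qed
    then have "row None ?M + x = snoc_vec 0 (c - d \<bullet> w)"
      by (simp add: vec_eq_iff x_def row_def bordered_def sum_negf inner_vec_def mult.commute
          snoc_vec_def split: option.split)
    then show ?thesis
      by (simp add: vec_eq_iff bordered_def row_def split: option.split)
  qed
  also have "det \<dots> = (c - d \<bullet> w) * det A"
    by (rule det_bordered_zero)
  finally show ?thesis
    by (simp add: w_def)
qed

text \<open>
  Completing the square: block elimination solves \<open>bordered A d d c *v (y, s) = (u, t)\<close> with
  \<open>s = (t - d \<bullet> A\<^bsup>-1\<^esup> u) / (c - d \<bullet> A\<^bsup>-1\<^esup> d)\<close> and \<open>y = A\<^bsup>-1\<^esup> u - s A\<^bsup>-1\<^esup> d\<close>. For a covariance matrix,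
  the two summands are, up to the factor \<open>-1/2\<close>, the exponents of the marginal and of the
  conditional density.
\<close>

lemma bordered_inverse_quadratic_form:
  fixes A :: "real ^ 'n ^ 'n"
  assumes inv: "invertible A" and sym: "transpose A = A"
    and nz: "c \<noteq> d \<bullet> (matrix_inv A *v d)"
  shows "snoc_vec u t \<bullet> (matrix_inv (bordered A d d c) *v snoc_vec u t) =
    u \<bullet> (matrix_inv A *v u) + (t - d \<bullet> (matrix_inv A *v u))\<^sup>2 / (c - d \<bullet> (matrix_inv A *v d))"
proof -
  have "det A \<noteq> 0"
    using inv invertible_det_nz by blast
  then have invB: "invertible (bordered A d d c)"
    using det_bordered_symmetric[OF inv sym, of d c] nz by (simp add: invertible_det_nz)
  define v where "v = matrix_inv A *v u"
  define w where "w = matrix_inv A *v d"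
  have vw: "A *v v = u" "A *v w = d"
    using matrix_inv_vector_eq_iff[OF inv] v_def w_def by metis+
  have dv: "u \<bullet> w = d \<bullet> v"
    using inner_symmetric_matrix[OF sym, of v w] vw by (metis inner_commute)
  define s where "s = (t - d \<bullet> v) / (c - d \<bullet> w)"
  have s: "s * (c - d \<bullet> w) = t - d \<bullet> v"
    using nz by (simp add: s_def w_def)
  have "bordered A d d c *v snoc_vec (v - s *\<^sub>R w) s = snoc_vec u t"
    using s by (simp add: bordered_mult_snoc_vec matrix_vector_mult_diff_distrib
        matrix_vector_mult_scaleR vw inner_diff_right algebra_simps)
  then have "matrix_inv (bordered A d d c) *v snoc_vec u t = snoc_vec (v - s *\<^sub>R w) s"
    using matrix_inv_vector_eq_iff[OF invB] by metis
  then have "snoc_vec u t \<bullet> (matrix_inv (bordered A d d c) *v snoc_vec u t) = u \<bullet> v + s * (t - d \<bullet> v)"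
    by (simp add: inner_snoc_vec inner_diff_right dv algebra_simps)
  also have "s * (t - d \<bullet> v) = (t - d \<bullet> v)\<^sup>2 / (c - d \<bullet> w)"
    by (simp add: s_def power2_eq_square)
  finally show ?thesis
    by (simp add: v_def w_def)
qed

section \<open>Lebesgue measure with an appended coordinate\<close>

lemma prod_Basis_vec: "(\<Prod>b\<in>(Basis :: (real ^ 'n) set). f b) = (\<Prod>i\<in>UNIV. f (axis i 1))"
proof -
  have "(Basis :: (real ^ 'n) set) = range (\<lambda>i. axis i 1)"
    by (auto simp: Basis_vec_def)
  then have *: "prod f (Basis :: (real ^ 'n) set) = prod f (range (\<lambda>i. axis i 1))"
    by (rule arg_cong)
  have "inj (\<lambda>i::'n. axis i (1::real))"
    by (auto simp: inj_def axis_eq_axis)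
  then show ?thesis
    unfolding * by (simp add: prod.reindex)
qed

lemma emeasure_lborel_box_vec:
  fixes l u :: "real ^ 'n"
  assumes "\<And>i. l $ i \<le> u $ i"
  shows "emeasure lborel (box l u) = ennreal (\<Prod>i\<in>UNIV. u $ i - l $ i)"
proof -
  have "emeasure lborel (box l u) = (\<Prod>b\<in>Basis. (u - l) \<bullet> b)"
    by (rule emeasure_lborel_box) (use assms in \<open>auto simp: Basis_vec_def inner_axis\<close>)
  then show ?thesis
    by (simp add: prod_Basis_vec inner_axis)
qed

lemma continuous_on_snoc_vec: "continuous_on UNIV (\<lambda>(x, t). snoc_vec x t :: real ^ ('n::finite) option)"
  unfolding snoc_vec_def case_prod_beta
proof (rule continuous_on_vec_lambda)
  show "continuous_on UNIV (\<lambda>p :: (real ^ 'n) \<times> real. case i of Some j \<Rightarrow> fst p $ j | None \<Rightarrow> snd p)" for i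
    by (cases i) (auto intro!: continuous_intros)
qed

lemma measurable_snoc_vec [measurable]:
  "(\<lambda>(x, t). snoc_vec x t :: real ^ ('n::finite) option) \<in> borel \<Otimes>\<^sub>M borel \<rightarrow>\<^sub>M borel"
  using borel_measurable_continuous_onI[OF continuous_on_snoc_vec] by (simp add: borel_prod)

text \<open>
  Both measures agree on boxes, since the preimage of a box is a box times an interval.
\<close>

lemma lborel_snoc_vec:
  "distr (lborel \<Otimes>\<^sub>M lborel) borel (\<lambda>(x, t). snoc_vec x t) = (lborel :: (real ^ ('n::finite) option) measure)"
proof (rule lborel_eqI[symmetric])
  fix l u :: "real ^ 'n option"
  assume lu: "\<And>b. b \<in> Basis \<Longrightarrow> l \<bullet> b \<le> u \<bullet> b"
  have le: "l $ i \<le> u $ i" for i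
    using lu[of "axis i 1"] by (simp add: inner_axis)
  obtain l' l0 u' u0 where l: "l = snoc_vec l' l0" and u: "u = snoc_vec u' u0"
    by (metis snoc_vec_cases)
  have le': "l' $ i \<le> u' $ i" "l0 \<le> u0" for i
    using le[of "Some i"] le[of None] by (simp_all add: l u)
  have "emeasure (distr (lborel \<Otimes>\<^sub>M lborel) borel (\<lambda>(x, t). snoc_vec x t)) (box l u) =
      emeasure (lborel \<Otimes>\<^sub>M lborel) ((\<lambda>(x, t). snoc_vec x t) -` box l u)"
    by (subst emeasure_distr) (auto simp: space_pair_measure measurable_cong_sets[OF sets_pair_measure_cong[OF sets_lborel sets_lborel] refl])
  also have "(\<lambda>(x, t). snoc_vec x t) -` box l u = box l' u' \<times> {l0<..<u0}"
    by (auto simp: l u mem_box_cart split_option_all)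
  also have "emeasure (lborel \<Otimes>\<^sub>M lborel) \<dots> = emeasure lborel (box l' u') * emeasure lborel {l0<..<u0}"
    by (rule lborel.emeasure_pair_measure_Times) auto
  also have "\<dots> = ennreal (\<Prod>i\<in>UNIV. u' $ i - l' $ i) * ennreal (u0 - l0)"
    using le' by (simp add: emeasure_lborel_box_vec)
  also have "\<dots> = ennreal (\<Prod>i\<in>UNIV. u $ i - l $ i)"
    using le' by (simp add: prod_UNIV_option l u prod_nonneg mult.commute flip: ennreal_mult)
  also have "\<dots> = ennreal (\<Prod>b\<in>Basis. (u - l) \<bullet> b)"
    by (simp add: prod_Basis_vec inner_axis)
  finally show "emeasure (distr (lborel \<Otimes>\<^sub>M lborel) borel (\<lambda>(x, t). snoc_vec x t)) (box l u) =
      ennreal (\<Prod>b\<in>Basis. (u - l) \<bullet> b)" .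
qed simp

lemma integral_snoc_vec:
  fixes f :: "real ^ ('n::finite) option \<Rightarrow> real"
  assumes [measurable]: "f \<in> borel_measurable borel"
  shows "(LINT z|lborel. f z) = (LINT p|(lborel \<Otimes>\<^sub>M lborel). f (snoc_vec (fst p) (snd p)))"
proof -
  have "(LINT z|lborel. f z) = (LINT z|distr (lborel \<Otimes>\<^sub>M lborel) borel (\<lambda>(x, t). snoc_vec x t). f z)"
    by (simp add: lborel_snoc_vec)
  also have "\<dots> = (LINT p|(lborel \<Otimes>\<^sub>M lborel). f (case p of (x, t) \<Rightarrow> snoc_vec x t))"
    by (rule integral_distr) (auto simp: measurable_cong_sets[OF sets_pair_measure_cong[OF sets_lborel sets_lborel] refl])
  finally show ?thesis
    by (simp add: case_prod_beta)
qed

text \<open>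
  Since the kernel is nonnegative, integrating out \<open>y\<close> turns \<open>\<bar>g x\<bar> k (x, y)\<close> into the absolute value
  of the integrand on the right. So the two sides are integrable together: either Fubini's theorem
  applies, or both integrals have the default value 0.
\<close>

lemma (in pair_sigma_finite) integral_kernel:
  fixes g :: "'a \<Rightarrow> real" and k :: "'a \<times> 'b \<Rightarrow> real"
  assumes [measurable]: "g \<in> borel_measurable M1" "k \<in> borel_measurable (M1 \<Otimes>\<^sub>M M2)"
    and nonneg: "\<And>p. 0 \<le> k p" and int: "\<And>x. integrable M2 (\<lambda>y. k (x, y))"
  shows "(LINT p|(M1 \<Otimes>\<^sub>M M2). g (fst p) * k p) = (LINT x|M1. g x * (LINT y|M2. k (x, y)))"
proof (cases "integrable (M1 \<Otimes>\<^sub>M M2) (\<lambda>p. g (fst p) * k p)")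
  case True
  then show ?thesis
    using integral_fst'[OF True] by simp
next
  case False
  have "\<not> integrable M1 (\<lambda>x. g x * (LINT y|M2. k (x, y)))"
  proof
    assume "integrable M1 (\<lambda>x. g x * (LINT y|M2. k (x, y)))"
    then have "integrable M1 (\<lambda>x. \<bar>g x * (LINT y|M2. k (x, y))\<bar>)"
      by (rule integrable_abs)
    then have "integrable M1 (\<lambda>x. LINT y|M2. norm (g (fst (x, y)) * k (x, y)))"
      using nonneg by (simp add: abs_mult)
    then have "integrable (M1 \<Otimes>\<^sub>M M2) (\<lambda>p. g (fst p) * k p)"
      using int by (intro Fubini_integrable) auto
    with False show False ..
  qed
  with False show ?thesis
    by (simp add: not_integrable_integral_eq)
qed

section \<open>Conditional Gaussian distributions\<close>

lemma integral_normal_density_atMost: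
  assumes "\<sigma> > 0"
  shows "(LINT t|lborel. indicator {..z} t * normal_density m \<sigma> t) = Phi1 ((z - m) / \<sigma>)"
proof -
  have eq: "indicator {..z} (m + \<sigma> * y) * normal_density m \<sigma> (m + \<sigma> * y) =
      inverse \<sigma> * (indicator {..(z - m) / \<sigma>} y * std_normal_density y)" for y
  proof -
    have "m + \<sigma> * y \<le> z \<longleftrightarrow> y \<le> (z - m) / \<sigma>"
      using assms by (simp add: field_simps)
    then show ?thesis
      using assms by (simp add: normal_density_def indicator_def power_mult_distrib real_sqrt_mult field_simps)
  qed
  have "(LINT t|lborel. indicator {..z} t * normal_density m \<sigma> t) =
      (LINT y|lborel. indicator {..(z - m) / \<sigma>} y * std_normal_density y)"
    using assms by (subst lborel_integral_real_affine[where c = \<sigma> and t = m]) (simp_all only: eq integral_mult_right_zero, simp_all)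
  also have "\<dots> = (LINT y|std_normal_distribution. indicator {..(z - m) / \<sigma>} y)"
    by (subst integral_density) (auto simp: mult.commute)
  also have "\<dots> = Phi1 ((z - m) / \<sigma>)"
    by (simp add: cdf_def)
  finally show ?thesis .
qed

text \<open>
  Disintegration of a Gaussian density: the marginal density of the first block times the
  conditional density of the last coordinate, whose variance is the Schur complement.
\<close>

lemma normal_dens_bordered:
  fixes S :: "real ^ 'n ^ 'n" and d :: "real ^ 'n"
  assumes inv: "invertible S" and sym: "transpose S = S"
    and pos: "c - d \<bullet> (matrix_inv S *v d) > 0"
  shows "normal_dens (snoc_vec \<mu> \<nu>) (bordered S d d c) (snoc_vec x t) =
    normal_dens \<mu> S x *
    normal_density (\<nu> + d \<bullet> (matrix_inv S *v (x - \<mu>))) (sqrt (c - d \<bullet> (matrix_inv S *v d))) t"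
proof -
  define v where "v = c - d \<bullet> (matrix_inv S *v d)"
  define q where "q = (x - \<mu>) \<bullet> (matrix_inv S *v (x - \<mu>))"
  define r where "r = d \<bullet> (matrix_inv S *v (x - \<mu>))"
  have v: "v > 0" using pos by (simp add: v_def)
  have "normal_dens (snoc_vec \<mu> \<nu>) (bordered S d d c) (snoc_vec x t) =
      exp (- (q + (t - \<nu> - r)\<^sup>2 / v) / 2) / sqrt ((2 * pi) ^ CARD('n option) * (v * det S))"
    unfolding normal_dens_def snoc_vec_diff
    using bordered_inverse_quadratic_form[OF inv sym, of c d] det_bordered_symmetric[OF inv sym] pos
    by (simp add: v_def q_def r_def)
  also have "exp (- (q + (t - \<nu> - r)\<^sup>2 / v) / 2) = exp (- q / 2) * exp (- (t - (\<nu> + r))\<^sup>2 / (2 * v))"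
    by (simp add: diff_diff_eq add_divide_distrib diff_divide_distrib mult.commute flip: exp_add)
  also have "sqrt ((2 * pi) ^ CARD('n option) * (v * det S)) =
      sqrt ((2 * pi) ^ CARD('n) * det S) * sqrt (2 * pi * v)"
    by (simp add: mult_ac flip: real_sqrt_mult)
  also have "exp (- q / 2) * exp (- (t - (\<nu> + r))\<^sup>2 / (2 * v)) / \<dots> =
      normal_dens \<mu> S x * normal_density (\<nu> + r) (sqrt v) t"
    using v by (simp add: normal_dens_def normal_density_def q_def)
  finally show ?thesis
    by (simp add: v_def r_def)
qed

section \<open>The parameters of the extended skew-normal distribution\<close>

context
  fixes S :: "real ^ 'n ^ 'n" and l :: "real ^ 'n"
  assumes S: "pos_def S"
begin

text \<open>
  The regression coefficients of the latent variable on the observed vector. The factor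
  \<open>\<Sigma>\<^bsup>1/2\<^esup>\<close> in \<open>\<Delta>\<close> turns \<open>\<Sigma>\<^bsup>-1\<^esup>\<close> into \<open>\<Sigma>\<^bsup>-1/2\<^esup>\<close>, by symmetry of the square root.
\<close>

lemma esn_Delta_regression:
  "esn_Delta S l \<bullet> (matrix_inv S *v v) = (l \<bullet> (matrix_inv (mat_sqrt S) *v v)) / sqrt (1 + l \<bullet> l)"
proof -
  let ?R = "mat_sqrt S"
  define w where "w = matrix_inv S *v v"
  have "v = S *v w"
    using matrix_inv_vector_eq_iff[OF pos_def_invertible[OF S]] w_def by metis
  also have "\<dots> = ?R *v (?R *v w)"
    by (simp add: matrix_vector_mul_assoc mat_sqrt(2)[OF S])
  finally have "matrix_inv ?R *v v = ?R *v w"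
    using matrix_inv_vector_eq_iff[OF pos_def_invertible[OF mat_sqrt(1)[OF S]]] by metis
  moreover have "(?R *v l) \<bullet> w = l \<bullet> (?R *v w)"
    using mat_sqrt(1)[OF S] by (simp add: pos_def_def inner_symmetric_matrix)
  ultimately show ?thesis
    by (simp add: esn_Delta_def w_def)
qed

text \<open>
  The conditional variance of the latent variable, that is, the Schur complement of \<open>\<Sigma>\<close> in \<open>\<Omega>\<close>.
\<close>

lemma esn_Delta_variance: "1 - esn_Delta S l \<bullet> (matrix_inv S *v esn_Delta S l) = 1 / (1 + l \<bullet> l)"
proof -
  let ?R = "mat_sqrt S"
  have "matrix_inv ?R *v (?R *v l) = l"
    using matrix_inv_vector_eq_iff[OF pos_def_invertible[OF mat_sqrt(1)[OF S]]] by metis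
  then have "matrix_inv ?R *v esn_Delta S l = (1 / sqrt (1 + l \<bullet> l)) *\<^sub>R l"
    by (simp add: esn_Delta_def matrix_vector_mult_scaleR)
  moreover have "1 + l \<bullet> l > 0"
    by (simp add: add_pos_nonneg)
  ultimately show ?thesis
    by (simp add: esn_Delta_regression field_simps)
qed

end

lemma esn_Omega_eq_bordered: "esn_Omega S l = bordered S (- esn_Delta S l) (- esn_Delta S l) 1"
  by (simp add: esn_Omega_def bordered_def snoc_vec_def vec_eq_iff split: option.split)

section \<open>Integrating out the appended coordinate\<close>

lemma monom_vec_snoc_vec: "monom_vec (snoc_vec x t) (snoc_vec \<kappa> 0) = monom_vec x \<kappa>"
  by (simp add: monom_vec_def prod_UNIV_option)

lemma snoc_vec_in_ebox_iff:
  "snoc_vec x t \<in> ebox (snoc_vec a (-\<infinity>)) (snoc_vec b (ereal z)) \<longleftrightarrow> x \<in> ebox a b \<and> t \<le> z"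
  by (auto simp: ebox_def split_option_all)

lemma measurable_ebox [measurable]: "ebox a b \<in> sets borel" for a b :: "ereal ^ 'n"
proof -
  have [measurable]: "(\<lambda>x. x $ i) \<in> borel_measurable borel" for i :: 'n
    by (intro borel_measurable_continuous_onI continuous_intros)
  have "{x \<in> space borel. \<forall>i\<in>UNIV. a $ i \<le> ereal (x $ i) \<and> ereal (x $ i) \<le> b $ i} \<in> sets borel"
    by measurable
  then show ?thesis
    by (simp add: ebox_def)
qed

lemma measurable_monom_vec [measurable]: "(\<lambda>x. monom_vec x \<kappa>) \<in> borel_measurable borel"
  unfolding monom_vec_def by (intro borel_measurable_continuous_onI continuous_intros)

lemma continuous_on_affine_solve: "continuous_on UNIV (\<lambda>x. A *v (x - \<mu>))" for A :: "real ^ 'n ^ 'm"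
  by (intro bounded_linear.continuous_on[OF matrix_vector_mul_bounded_linear] continuous_intros)

lemma measurable_normal_dens [measurable]: "normal_dens \<mu> S \<in> borel_measurable borel"
  unfolding normal_dens_def[abs_def] divide_inverse
  by (intro borel_measurable_continuous_onI continuous_intros continuous_on_affine_solve)

text \<open>
  The integrand of the Gaussian integral splits into \<open>g x\<close>, which collects what depends on the
  old coordinates only, and a kernel \<open>k\<close>, the conditional density of the last coordinate
  restricted to its range of integration. The integral of the kernel is the skewing factor.
\<close>

lemma esn_F_eq_normal_F:
  fixes \<mu> l :: "real ^ 'n" and S :: "real ^ 'n ^ 'n"
  assumes S: "pos_def S"
  shows "esn_F \<kappa> a b \<mu> S l \<tau> = inverse (esn_xi l \<tau>) *
    normal_F (snoc_vec \<kappa> 0) (snoc_vec a (-\<infinity>)) (snoc_vec b (ereal (tau_tilde l \<tau>)))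
      (snoc_vec \<mu> 0) (esn_Omega S l)"
proof -
  have inv: "invertible S" and sym: "transpose S = S"
    using S pos_def_invertible by (auto simp: pos_def_def)
  define \<Delta> where "\<Delta> = esn_Delta S l"
  define \<sigma> where "\<sigma> = 1 / sqrt (1 + l \<bullet> l)"
  define z where "z = tau_tilde l \<tau>"
  define m where "m = (\<lambda>x. - \<Delta> \<bullet> (matrix_inv S *v (x - \<mu>)))"
  define g where "g = (\<lambda>x. indicator (ebox a b) x * (monom_vec x \<kappa> * normal_dens \<mu> S x))"
  define k where "k = (\<lambda>p. indicator {..z} (snd p) * normal_density (m (fst p)) \<sigma> (snd p))"
  have "1 + l \<bullet> l > 0"
    by (simp add: add_pos_nonneg)
  then have \<sigma>: "\<sigma> > 0"
    by (simp add: \<sigma>_def)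
  have var: "1 - (- \<Delta>) \<bullet> (matrix_inv S *v (- \<Delta>)) = 1 / (1 + l \<bullet> l)"
    using esn_Delta_variance[OF S, of l] by (simp add: \<Delta>_def linear_neg[OF matrix_vector_mul_linear])
  have dens: "normal_dens (snoc_vec \<mu> 0) (esn_Omega S l) (snoc_vec x t) =
      normal_dens \<mu> S x * normal_density (m x) \<sigma> t" for x t
    using normal_dens_bordered[OF inv sym, where d = "- \<Delta>" and c = 1 and \<mu> = \<mu> and \<nu> = 0 and x = x and t = t] \<open>1 + l \<bullet> l > 0\<close>
    unfolding var by (simp add: esn_Omega_eq_bordered \<Delta>_def m_def \<sigma>_def real_sqrt_divide)
  have [measurable]: "m \<in> borel_measurable borel"
    unfolding m_def by (intro borel_measurable_continuous_onI continuous_intros continuous_on_affine_solve)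
  have [measurable]: "g \<in> borel_measurable lborel"
    unfolding g_def by measurable
  have [measurable]: "k \<in> borel_measurable (lborel \<Otimes>\<^sub>M lborel)"
    unfolding k_def normal_density_def by measurable
  have cond: "(LINT t|lborel. k (x, t)) = Phi1 (\<tau> + l \<bullet> (matrix_inv (mat_sqrt S) *v (x - \<mu>)))" for x
  proof -
    have "(LINT t|lborel. k (x, t)) = Phi1 ((z - m x) / \<sigma>)"
      using integral_normal_density_atMost[OF \<sigma>] by (simp add: k_def)
    also have "(z - m x) / \<sigma> = \<tau> + l \<bullet> (matrix_inv (mat_sqrt S) *v (x - \<mu>))"
      using \<open>1 + l \<bullet> l > 0\<close>
      by (simp add: z_def m_def \<Delta>_def esn_Delta_regression[OF S] tau_tilde_def \<sigma>_def field_simps)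
    finally show ?thesis .
  qed
  have "normal_F (snoc_vec \<kappa> 0) (snoc_vec a (-\<infinity>)) (snoc_vec b (ereal z)) (snoc_vec \<mu> 0) (esn_Omega S l) =
      (LINT p|(lborel \<Otimes>\<^sub>M lborel). g (fst p) * k p)"
    unfolding normal_F_def set_lebesgue_integral_def
    by (subst integral_snoc_vec)
      (auto simp: g_def k_def dens monom_vec_snoc_vec indicator_def snoc_vec_in_ebox_iff
        intro!: Bochner_Integration.integral_cong)
  also have "\<dots> = (LINT x|lborel. g x * (LINT t|lborel. k (x, t)))"
  proof (rule lborel_pair.integral_kernel)
    show "0 \<le> k p" for p
      by (simp add: k_def)
    show "integrable lborel (\<lambda>t. k (x, t))" for x
      using integrable_real_mult_indicator[of "{..z}" lborel "normal_density (m x) \<sigma>"] \<sigma>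
      by (simp add: k_def mult.commute)
  qed measurable
  finally have F: "normal_F (snoc_vec \<kappa> 0) (snoc_vec a (-\<infinity>)) (snoc_vec b (ereal z)) (snoc_vec \<mu> 0) (esn_Omega S l) =
      (LINT x|lborel. g x * Phi1 (\<tau> + l \<bullet> (matrix_inv (mat_sqrt S) *v (x - \<mu>))))"
    by (simp add: cond)
  show ?thesis
    unfolding z_def[symmetric] F esn_F_def set_lebesgue_integral_def
    by (simp add: g_def esn_dens_def mult_ac flip: integral_mult_right_zero)
qed

theorem theorem2:
  fixes \<mu> l :: "real ^ 'n" and S :: "real ^ 'n ^ 'n" and \<tau> :: real
    and a b :: "ereal ^ 'n" and \<kappa> :: "nat ^ 'n"
  assumes "pos_def S"
  shows "esn_F \<kappa> a b \<mu> S l \<tau> =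
           inverse (esn_xi l \<tau>) *
           normal_F (snoc_vec \<kappa> 0) (snoc_vec a (-\<infinity>)) (snoc_vec b (ereal (tau_tilde l \<tau>)))
             (snoc_vec \<mu> 0) (esn_Omega S l)
       \<and> esn_L a b \<mu> S l \<tau> =
           inverse (esn_xi l \<tau>) *
           normal_L (snoc_vec a (-\<infinity>)) (snoc_vec b (ereal (tau_tilde l \<tau>)))
             (snoc_vec \<mu> 0) (esn_Omega S l)"
proof -
  have "snoc_vec (0 :: nat ^ 'n) 0 = 0"
    by (simp add: vec_eq_iff snoc_vec_def split: option.split)
  then show ?thesis
    using esn_F_eq_normal_F[OF assms, of \<kappa> a b \<mu> l \<tau>] esn_F_eq_normal_F[OF assms, of 0 a b \<mu> l \<tau>]
    by (simp add: esn_L_def normal_L_def)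
qed

end
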